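(* Let $Q\in\mathbb{R}^{n\times n}$ be symmetric with $\lambda_Q<0$, let $g\in\mathbb{R}^n$, $A\in\mathbb{R}^{m\times n}$, $b\in\mathbb{R}^m$, and let $\mathcal{K}\subseteq\mathbb{R}^m$ be a closed convex cone such that $\{y\in\mathbb{R}^n:\|y\|\le 1,\ Ay-b\in\mathcal{K}\}$ is nonempty. Suppose that there exists $d\in\mathbb{R}^n$, $d\ne0$, such that $Qd=\lambda_Q d$, $Ad\in\mathcal{K}$ and $-Ad\in\mathcal{K}$. Let $\mathcal{R}=\mathbb{R}^n\setminus\mathcal{P}$, where $\mathcal{P}\subseteq\mathbb{R}^n$ is a (possibly nonconvex) set satisfying $$\mathcal{P}\subseteq\{y:\ \|y\|<1,\ Ay-b\in\mathcal{K}\}.$$ Let $$X:=\left\{[y;1;x_{n+2}]\in\mathbb{R}^{n+2}:\ \|y\|\le 1,\ Ay-b\in\mathcal{K},\ y^\top Qy+2g^\top y\le x_{n+2}\right\}.$$ Then $$\mathrm{conv}\left(\left\{[y;1;x_{n+2}]:\ \|y\|\le 1,\ y\in\mathcal{R},\ Ay-b\in\mathcal{K},\ y^\top Qy+2g^\top y\le x_{n+2}\right\}\right)=\mathrm{conv}(X).$$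
   Context: $\|\cdot\|$ is the Euclidean norm, $\lambda_Q:=\lambda_{\min}(Q)$ is the minimum eigenvalue of $Q$, and $\mathrm{conv}$ denotes the convex hull. $[y;1;x_{n+2}]$ denotes the vector in $\mathbb{R}^{n+2}$ obtained by stacking $y\in\mathbb{R}^n$, $1$ and $x_{n+2}\in\mathbb{R}$. *)

theory Defs
  imports "HOL-Analysis.Analysis"
begin

definition eigenvalues :: "real ^ 'n ^ 'n \<Rightarrow> real set"
  where "eigenvalues Q = {l. \<exists>v. v \<noteq> 0 \<and> Q *v v = l *\<^sub>R v}"

text \<open>\<open>Min\<close> is only meaningful on a finite nonempty set; the lemmas below show that
  the spectrum of a symmetric matrix is one.\<close>

definition lambda_min :: "real ^ 'n ^ 'n \<Rightarrow> real"
  where "lambda_min Q = Min (eigenvalues Q)"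

lemma symmetric_matrix_inner:
  fixes Q :: "real ^ 'n ^ 'n"
  assumes "transpose Q = Q"
  shows "(Q *v x) \<bullet> y = x \<bullet> (Q *v y)"
  using dot_lmul_matrix[of x Q y] assms
  by (metis transpose_matrix_vector)

lemma finite_eigenvalues:
  fixes Q :: "real ^ 'n ^ 'n"
  assumes "transpose Q = Q"
  shows "finite (eigenvalues Q)"
proof -
  have "\<exists>f. \<forall>l\<in>eigenvalues Q. f l \<noteq> 0 \<and> Q *v f l = l *\<^sub>R f l"
    by (rule bchoice) (auto simp: eigenvalues_def)
  then obtain f where f: "\<And>l. l \<in> eigenvalues Q \<Longrightarrow> f l \<noteq> 0"
      "\<And>l. l \<in> eigenvalues Q \<Longrightarrow> Q *v f l = l *\<^sub>R f l"
    by blast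
  have orth: "f k \<bullet> f l = 0" if "k \<in> eigenvalues Q" "l \<in> eigenvalues Q" "k \<noteq> l" for k l
  proof -
    have "k * (f k \<bullet> f l) = l * (f k \<bullet> f l)"
      using symmetric_matrix_inner[OF assms, of "f k" "f l"] f(2) that by simp
    with that show ?thesis by simp
  qed
  have inj: "inj_on f (eigenvalues Q)"
  proof (rule inj_onI, rule ccontr)
    fix k l assume "k \<in> eigenvalues Q" "l \<in> eigenvalues Q" "f k = f l" "k \<noteq> l"
    then show False using orth[of k l] f(1)[of l] by simp
  qed
  have "pairwise orthogonal (f ` eigenvalues Q)"
    using orth by (auto simp: pairwise_def orthogonal_def)
  moreover have "0 \<notin> f ` eigenvalues Q"
    using f(1) by force
  ultimately have "finite (f ` eigenvalues Q)"
    by (intro independent_imp_finite pairwise_orthogonal_independent)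
  then show ?thesis
    using inj by (rule finite_imageD)
qed

lemma eigenvalues_nonempty:
  fixes Q :: "real ^ 'n ^ 'n"
  assumes sym: "transpose Q = Q"
  shows "eigenvalues Q \<noteq> {}"
proof -
  have "sphere (0 :: real ^ 'n) 1 \<noteq> {}"
    by (simp add: sphere_eq_empty)
  moreover have "continuous_on (sphere 0 1) (\<lambda>x. x \<bullet> (Q *v x))"
    by (intro continuous_intros linear_continuous_on matrix_vector_mul_bounded_linear)
  ultimately obtain u where u: "norm u = 1"
    and min: "\<And>x. norm x = 1 \<Longrightarrow> u \<bullet> (Q *v u) \<le> x \<bullet> (Q *v x)"
    using continuous_attains_inf[OF compact_sphere, of 0 1 "\<lambda>x. x \<bullet> (Q *v x)"] by auto
  define l where "l = u \<bullet> (Q *v u)"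
  define M where "M = (\<lambda>x. Q *v x - l *\<^sub>R x)"
  have Madd: "M (x + y) = M x + M y" and Mscale: "M (c *\<^sub>R x) = c *\<^sub>R M x" for x y c
    by (simp_all add: M_def matrix_vector_right_distrib matrix_vector_mult_scaleR algebra_simps)
  have Msym: "x \<bullet> M y = y \<bullet> M x" for x y
    using symmetric_matrix_inner[OF sym, of x y]
    by (simp add: M_def inner_diff_right inner_commute)
  have psd: "0 \<le> x \<bullet> M x" for x
  proof (cases "x = 0")
    case False
    define c where "c = norm x"
    define z where "z = x /\<^sub>R c"
    have "c > 0" "norm z = 1" "x = c *\<^sub>R z"
      using False by (auto simp: c_def z_def)
    moreover have "0 \<le> z \<bullet> M z"
      using min[OF \<open>norm z = 1\<close>] \<open>norm z = 1\<close>
      by (simp add: M_def l_def inner_diff_right dot_square_norm)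
    ultimately show ?thesis
      by (simp add: Mscale)
  qed simp
  have Mu: "u \<bullet> M u = 0"
    using u by (simp add: M_def l_def inner_diff_right dot_square_norm)
  define a where "a = M u \<bullet> M u"
  define c where "c = M u \<bullet> M (M u)"
  have quad: "0 \<le> 2 * t * a + t\<^sup>2 * c" for t
  proof -
    have "0 \<le> (u + t *\<^sub>R M u) \<bullet> M (u + t *\<^sub>R M u)"
      by (rule psd)
    also have "\<dots> = 2 * t * a + t\<^sup>2 * c"
      using Mu Msym[of u "M u"]
      by (simp add: Madd Mscale inner_add_left inner_add_right a_def c_def
          power2_eq_square algebra_simps)
    finally show ?thesis .
  qed
  have "c \<ge> 0" "a \<ge> 0"
    by (simp_all add: c_def a_def psd)
  have "a = 0"
  proof -
    define d where "d = c + 1"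
    have "d > 0" "c = d - 1"
      using \<open>c \<ge> 0\<close> by (auto simp: d_def)
    have "0 \<le> 2 * (- a / d) * a + (- a / d)\<^sup>2 * c"
      by (rule quad)
    also have "\<dots> = - (a\<^sup>2 * (d + 1) / d\<^sup>2)"
      using \<open>d > 0\<close> unfolding \<open>c = d - 1\<close> by (simp add: field_simps power2_eq_square)
    finally have "a\<^sup>2 * (d + 1) / d\<^sup>2 \<le> 0"
      by simp
    with \<open>d > 0\<close> show ?thesis
      by (simp add: divide_le_0_iff mult_le_0_iff)
  qed
  then have "Q *v u = l *\<^sub>R u"
    by (simp add: a_def M_def)
  moreover have "u \<noteq> 0"
    using u by auto
  ultimately show ?thesis
    by (auto simp: eigenvalues_def)
qed

text \<open>The stacked vector \<open>[y; s; t]\<close>; the two trailing coordinates have indices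
  \<open>Inr 0\<close> and \<open>Inr 1\<close>, where \<open>2\<close> is the two-element type.\<close>

definition stack :: "real ^ 'n \<Rightarrow> real \<Rightarrow> real \<Rightarrow> real ^ ('n + 2)"
  where "stack y s t = (\<chi> i. case i of Inl j \<Rightarrow> y $ j | Inr k \<Rightarrow> if k = 0 then s else t)"

end

theory Submission
  imports Defs
begin

text \<open>A point of \<open>X\<close> with \<open>norm y = 1\<close> avoids \<open>P\<close>. Otherwise the line through \<open>y\<close> in direction
  \<open>d\<close> stays feasible for the conic constraint and leaves the unit ball on both sides of \<open>y\<close>. Since
  the objective is concave along that line, its tangent at \<open>y\<close>, shifted up to pass through
  \<open>x\<^bsub>n+2\<^esub>\<close>, lies above it; so the point of \<open>X\<close> is on a segment joining two points of \<open>X\<close> over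
  the unit sphere.\<close>

text \<open>The direction has middle entry 0, so moving along it keeps the fixed coordinate of the
  points of \<open>X\<close> equal to 1.\<close>

lemma stack_add_scaleR:
  "stack (y + s *\<^sub>R d) a (t + s * \<beta>) = stack y a t + s *\<^sub>R stack d 0 \<beta>"
  by (auto simp: stack_def vec_eq_iff split: sum.split)

text \<open>Intermediate value theorem: the norm starts below \<open>r\<close> and is at least
  \<open>r\<close> far enough along the ray.\<close>

lemma ex_pos_norm_add_scaleR_eq:
  fixes y d :: "'a::real_normed_vector"
  assumes "norm y < r" "d \<noteq> 0"
  shows "\<exists>s>0. norm (y + s *\<^sub>R d) = r"
proof -
  \<comment> \<open>Chosen so that \<open>u * norm d - norm y = r\<close>, the lower bound that the
    triangle inequality gives for the norm at parameter \<open>u\<close>.\<close>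
  define u where "u = (r + norm y) / norm d"
  have "r > 0"
    using assms(1) norm_ge_zero[of y] by linarith
  then have u: "u \<ge> 0" "u * norm d = r + norm y"
    using assms(2) by (simp_all add: u_def)
  have "r \<le> norm (y + u *\<^sub>R d)"
    using norm_triangle_ineq4[of "y + u *\<^sub>R d" y] u by simp
  moreover have "continuous_on {0..u} (\<lambda>s. norm (y + s *\<^sub>R d))"
    by (intro continuous_intros)
  ultimately obtain s where s: "0 \<le> s" "norm (y + s *\<^sub>R d) = r"
    using IVT'[of "\<lambda>s. norm (y + s *\<^sub>R d)" 0 r u] assms(1) u(1) by auto
  moreover have "s \<noteq> 0"
    using s(2) assms(1) by auto
  ultimately show ?thesis
    by (intro exI[of _ s]) simp
qed

text \<open>Each endpoint is weighted by the step length of the other one, so the multiples of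
  \<open>v\<close> cancel.\<close>

lemma mem_convex_hull_opposite_points:
  assumes "p + s *\<^sub>R v \<in> S" "p - r *\<^sub>R v \<in> S" "s > 0" "r > 0"
  shows "p \<in> convex hull S"
proof -
  have "(r / (s + r)) *\<^sub>R (p + s *\<^sub>R v) + (s / (s + r)) *\<^sub>R (p - r *\<^sub>R v) \<in> convex hull S"
    using assms
    by (intro convexD[OF convex_convex_hull] hull_inc)
      (simp_all add: add_divide_distrib[symmetric] add.commute)
  also have "(r / (s + r)) *\<^sub>R (p + s *\<^sub>R v) + (s / (s + r)) *\<^sub>R (p - r *\<^sub>R v)
      = (r / (s + r) + s / (s + r)) *\<^sub>R p"
    by (simp add: algebra_simps)
  also have "\<dots> = p"
    using assms(3,4) by (simp add: add_divide_distrib[symmetric] add.commute)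
  finally show ?thesis .
qed

text \<open>By symmetry of \<open>Q\<close> both cross terms equal
  \<open>s * l * (d \<bullet> y)\<close>. The expansion in \<open>s\<close> then exceeds the
  right-hand side by exactly \<open>l * s\<^sup>2 * (d \<bullet> d)\<close>, which is
  nonpositive.\<close>

lemma quadratic_line_le_tangent:
  fixes Q :: "real ^ 'n ^ 'n"
  assumes "transpose Q = Q" "Q *v d = l *\<^sub>R d" "l \<le> 0"
  shows "(y + s *\<^sub>R d) \<bullet> (Q *v (y + s *\<^sub>R d)) + 2 * (g \<bullet> (y + s *\<^sub>R d))
    \<le> y \<bullet> (Q *v y) + 2 * (g \<bullet> y) + s * (2 * l * (d \<bullet> y) + 2 * (g \<bullet> d))"
proof -
  have "d \<bullet> (Q *v y) = l * (d \<bullet> y)"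
    using symmetric_matrix_inner[OF assms(1), of d y] assms(2) by simp
  then have "(y + s *\<^sub>R d) \<bullet> (Q *v (y + s *\<^sub>R d)) + 2 * (g \<bullet> (y + s *\<^sub>R d))
    = y \<bullet> (Q *v y) + 2 * (g \<bullet> y) + s * (2 * l * (d \<bullet> y) + 2 * (g \<bullet> d))
      + l * (s\<^sup>2 * (d \<bullet> d))"
    using assms(2)
    by (simp add: matrix_vector_right_distrib matrix_vector_mult_scaleR inner_commute
        inner_add_left inner_add_right power2_eq_square algebra_simps)
  moreover have "l * (s\<^sup>2 * (d \<bullet> d)) \<le> 0"
    using assms(3) by (intro mult_nonpos_nonneg) simp_all
  ultimately show ?thesis
    by simp
qed

theorem theorem17:
  fixes Q :: "real ^ 'n ^ 'n" and g :: "real ^ 'n"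
    and A :: "real ^ 'n ^ 'm" and b :: "real ^ 'm"
    and K :: "(real ^ 'm) set"
    and P R :: "(real ^ 'n) set" and X :: "(real ^ ('n + 2)) set"
  assumes "transpose Q = Q"
    and "lambda_min Q < 0"
    and "closed K" and "convex_cone K"
    and "{y. norm y \<le> 1 \<and> A *v y - b \<in> K} \<noteq> {}"
    and "\<exists>d. d \<noteq> 0 \<and> Q *v d = lambda_min Q *\<^sub>R d \<and> A *v d \<in> K \<and> - (A *v d) \<in> K"
    and "P \<subseteq> {y. norm y < 1 \<and> A *v y - b \<in> K}"
    and "R = UNIV - P"
    and "X = {stack y 1 t | y t. norm y \<le> 1 \<and> A *v y - b \<in> K
                \<and> y \<bullet> (Q *v y) + 2 * (g \<bullet> y) \<le> t}"
  shows "convex hull {stack y 1 t | y t. norm y \<le> 1 \<and> y \<in> R \<and> A *v y - b \<in> K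
                \<and> y \<bullet> (Q *v y) + 2 * (g \<bullet> y) \<le> t}
         = convex hull X"
    (is "convex hull ?Y = _")
proof -
  obtain d where d: "d \<noteq> 0" "Q *v d = lambda_min Q *\<^sub>R d" "A *v d \<in> K" "- (A *v d) \<in> K"
    using assms(6) by blast
  \<comment> \<open>\<open>K\<close> contains \<open>A *v d\<close> and its negative, hence every
    real multiple of it, and is closed under addition.\<close>
  have line_in_K: "A *v (y + s *\<^sub>R d) - b \<in> K" if "A *v y - b \<in> K" for y s
  proof -
    have "s *\<^sub>R (A *v d) \<in> K"
    proof (cases "s \<ge> 0")
      case True
      then show ?thesis
        using convex_cone_scaleR[OF assms(4)] d(3) by simp
    next
      case False
      then show ?thesis
        using convex_cone_scaleR[OF assms(4) _ d(4), of "- s"] by simp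
    qed
    then have "(A *v y - b) + s *\<^sub>R (A *v d) \<in> K"
      using convex_cone_add[OF assms(4) that] by simp
    then show ?thesis
      by (simp add: matrix_vector_right_distrib matrix_vector_mult_scaleR algebra_simps)
  qed
  have sphere_in_Y: "stack y 1 t \<in> ?Y"
    if "norm y = 1" "A *v y - b \<in> K" "y \<bullet> (Q *v y) + 2 * (g \<bullet> y) \<le> t" for y t
    using that assms(7,8) by fastforce
  have "X \<subseteq> convex hull ?Y"
  proof
    fix x assume "x \<in> X"
    then obtain y t where x: "x = stack y 1 t" and y: "norm y \<le> 1" "A *v y - b \<in> K"
      and t: "y \<bullet> (Q *v y) + 2 * (g \<bullet> y) \<le> t"
      using assms(9) by blast
    show "x \<in> convex hull ?Y"
    proof (cases "norm y = 1")
      case True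
      with x y(2) t show ?thesis
        by (intro hull_inc) (simp only: sphere_in_Y)
    next
      case False
      with y(1) have "norm y < 1"
        by simp
      then obtain s r where s: "s > 0" "norm (y + s *\<^sub>R d) = 1"
        and r: "r > 0" "norm (y + r *\<^sub>R (- d)) = 1"
        using ex_pos_norm_add_scaleR_eq[of y 1] d(1) by (metis neg_equal_0_iff_equal)
      \<comment> \<open>The slope of the objective at \<open>y\<close> along \<open>d\<close>. One
        slope serves both directions, so the two lifted endpoints are collinear with
        \<open>x\<close>.\<close>
      define \<beta> where "\<beta> = 2 * lambda_min Q * (d \<bullet> y) + 2 * (g \<bullet> d)"
      have in_Y: "x + c *\<^sub>R stack d 0 \<beta> \<in> ?Y" if "norm (y + c *\<^sub>R d) = 1" for c
        unfolding x stack_add_scaleR[symmetric]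
      proof (rule sphere_in_Y[OF that line_in_K[OF y(2)]])
        show "(y + c *\<^sub>R d) \<bullet> (Q *v (y + c *\<^sub>R d)) + 2 * (g \<bullet> (y + c *\<^sub>R d)) \<le> t + c * \<beta>"
          using quadratic_line_le_tangent[OF assms(1) d(2), of y c g] assms(2) t
          by (simp add: \<beta>_def)
      qed
      show ?thesis
        \<comment> \<open>The step \<open>r\<close> along \<open>- d\<close> is the parameter
          \<open>- r\<close> along \<open>d\<close>.\<close>
        using mem_convex_hull_opposite_points[of x s "stack d 0 \<beta>" ?Y r]
          in_Y[of s] in_Y[of "- r"] s r by simp
    qed
  qed
  moreover have "?Y \<subseteq> X"
    using assms(9) by blast
  ultimately show ?thesis
    by (intro equalityI hull_mono hull_minimal convex_convex_hull)
qed

end
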